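(* Let $G$ be an ordered additive abelian group with order $\preceq$ and let $h\geq 2$ be an integer. For every integer $k\geq 4$ the following holds: if $a,b_1,\dots,b_{k-2}\in G$ are all positive (i.e. $0\prec a$ and $0\prec b_i$ for all $i$), $b_{k-2}=b_{k-3}$, and $$A=\{0,\,a,\,a+b_1,\,a+b_1+b_2,\,\dots,\,a+b_1+\cdots+b_{k-2}\},$$ then either $A$ is a $k$-term arithmetic progression, or the set $$B=\{0,\,a,\,a+b_1,\,\dots,\,a+b_1+\cdots+b_{k-3}\}$$ has the property that $hB$ has at least $h-1$ nontrivial elements.
   Context: An ordered additive abelian group is an additive abelian group $G$ with a total order $\preceq$ such that for all $x,y,z\in G$, $x\prec y$ implies $x+z\prec y+z$ (here $\prec$ means $\preceq$ and $\neq$). For an integer $h\geq 2$ and $A\subseteq G$, the $h$-fold sumset is $hA=\{x_1+\cdots+x_h : x_1,\dots,x_h\in A\}$. If $B=\{x_1,\dots,x_m\}$ with $x_1\prec x_2\prec\cdots\prec x_m$, an element of $hB$ is called trivial (with respect to $B$) if it equals $(h-i)x_j+ix_{j+1}$ for some integers $0\leq i\leq h$ and $1\leq j\leq m-1$; otherwise it is called nontrivial. A $k$-term arithmetic progression is a set of the form $\{x, x+g, x+2g,\dots,x+(k-1)g\}$ with $g\neq 0$. *)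

theory Defs
  imports Main "HOL-Library.FuncSet"
begin

text \<open>The multiple \<open>n x\<close> of an element of an additive commutative monoid by a natural number.\<close>

definition nmult :: "nat \<Rightarrow> 'a::comm_monoid_add \<Rightarrow> 'a" where
  "nmult n x = (\<Sum>i<n. x)"

definition hfold_sumset :: "nat \<Rightarrow> 'a::comm_monoid_add set \<Rightarrow> 'a set" where
  "hfold_sumset h A = {(\<Sum>i=1..h. x i) | x. x \<in> {1..h} \<rightarrow> A}"

text \<open>
  Only meant for finite \<open>B\<close>. The increasing enumeration \<open>x\<^sub>1, \<dots>, x\<^sub>m\<close> of \<open>B\<close> is
  \<open>sorted_list_of_set B\<close>, indexed from \<open>0\<close>, so that \<open>1 \<le> j \<le> m - 1\<close> becomes \<open>j + 1 < m\<close>.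
\<close>

definition trivial_element :: "nat \<Rightarrow> 'a::linordered_ab_group_add set \<Rightarrow> 'a \<Rightarrow> bool" where
  "trivial_element h B y \<longleftrightarrow>
     (\<exists>i j. i \<le> h \<and> j + 1 < card B \<and>
        y = nmult (h - i) (sorted_list_of_set B ! j) + nmult i (sorted_list_of_set B ! (j + 1)))"

definition nontrivial_elements :: "nat \<Rightarrow> 'a::linordered_ab_group_add set \<Rightarrow> 'a set" where
  "nontrivial_elements h B = {y \<in> hfold_sumset h B. \<not> trivial_element h B y}"

definition is_arith_prog :: "nat \<Rightarrow> 'a::ab_group_add set \<Rightarrow> bool" where
  "is_arith_prog k A \<longleftrightarrow> (\<exists>x g. g \<noteq> 0 \<and> A = {x + nmult i g | i. i < k})"

end

theory Submission
  imports Defs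
begin

text \<open>
  Since the last two gaps of \<open>A\<close> agree, \<open>A\<close> is an arithmetic progression as soon as all gaps of
  \<open>B\<close> agree. Otherwise let \<open>p\<close> be the first gap and \<open>q\<close> the first gap different from \<open>p\<close>, so that
  \<open>B\<close> starts with \<open>0, p, \<dots>, r p, r p + q\<close>. Below \<open>h (r p + q)\<close> the trivial elements are \<open>i p\<close> with
  \<open>i \<le> h r\<close> and \<open>h r p + i q\<close> with
  \<open>i < h\<close>. If \<open>q\<close> is not a multiple of \<open>p\<close>, then the sums \<open>i r p + q\<close> with
  \<open>1 \<le> i \<le> h - 1\<close> are nontrivial. If \<open>q = m p\<close> with \<open>m \<ge> 2\<close>, then the sums \<open>(h r - 1) p + i q\<close>
  with \<open>1 \<le> i \<le> h - 1\<close> are nontrivial.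
\<close>

section \<open>Multiples in an ordered abelian group\<close>

lemma nmult_0 [simp]: "nmult 0 x = 0"
  and nmult_Suc [simp]: "nmult (Suc n) x = x + nmult n x"
  by (simp_all add: nmult_def add.commute)

lemma nmult_zero_right [simp]: "nmult n 0 = 0"
  by (simp add: nmult_def)

lemma nmult_add_left: "nmult (m + n) x = nmult m x + nmult n x"
  by (induction m) (simp_all add: add.assoc)

lemma nmult_add_right: "nmult n (x + y) = nmult n x + nmult n y"
  by (simp add: nmult_def sum.distrib)

lemma nmult_nmult: "nmult m (nmult n x) = nmult (m * n) x"
  by (induction m) (simp_all add: nmult_add_left)

lemma nmult_mono:
  fixes x y :: "'a::linordered_ab_group_add"
  shows "x \<le> y \<Longrightarrow> nmult n x \<le> nmult n y"
  by (simp add: nmult_def sum_mono)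

lemma nmult_strict_mono_left:
  fixes x :: "'a::linordered_ab_group_add"
  assumes "0 < x"
  shows "strict_mono (\<lambda>n. nmult n x)"
  using assms by (simp add: strict_mono_Suc_iff)

lemma nmult_less_iff:
  fixes x :: "'a::linordered_ab_group_add"
  shows "0 < x \<Longrightarrow> nmult m x < nmult n x \<longleftrightarrow> m < n"
  using nmult_strict_mono_left[of x] by (rule strict_mono_less)

lemma nmult_le_iff:
  fixes x :: "'a::linordered_ab_group_add"
  shows "0 < x \<Longrightarrow> nmult m x \<le> nmult n x \<longleftrightarrow> m \<le> n"
  using nmult_strict_mono_left[of x] by (rule strict_mono_less_eq)

lemma nmult_eq_iff:
  fixes x :: "'a::linordered_ab_group_add"
  shows "0 < x \<Longrightarrow> nmult m x = nmult n x \<longleftrightarrow> m = n"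
  using nmult_strict_mono_left[of x] by (rule strict_mono_eq)

section \<open>Sumsets, built one summand at a time\<close>

lemma hfold_sumset_0: "hfold_sumset 0 A = {0}"
  by (auto simp: hfold_sumset_def)

lemma hfold_sumset_Suc:
  "hfold_sumset (Suc h) A = (\<lambda>(x, y). x + y) ` (A \<times> hfold_sumset h A)"
proof (intro equalityI subsetI)
  fix z assume "z \<in> hfold_sumset (Suc h) A"
  then obtain x where x: "x \<in> {1..Suc h} \<rightarrow> A" and z: "z = (\<Sum>i=1..Suc h. x i)"
    by (auto simp: hfold_sumset_def)
  have "(\<Sum>i=1..h. x i) \<in> hfold_sumset h A"
    using x by (fastforce simp: hfold_sumset_def)
  moreover have "x (Suc h) \<in> A"
    using x by auto
  moreover have "z = x (Suc h) + (\<Sum>i=1..h. x i)"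
    by (simp add: z add.commute)
  ultimately show "z \<in> (\<lambda>(x, y). x + y) ` (A \<times> hfold_sumset h A)"
    by force
next
  fix z assume "z \<in> (\<lambda>(x, y). x + y) ` (A \<times> hfold_sumset h A)"
  then obtain u x where u: "u \<in> A" and x: "x \<in> {1..h} \<rightarrow> A" and z: "z = u + (\<Sum>i=1..h. x i)"
    by (auto simp: hfold_sumset_def)
  let ?x = "x(Suc h := u)"
  have "?x \<in> {1..Suc h} \<rightarrow> A"
    using u x by (auto simp: Pi_iff)
  moreover have "z = (\<Sum>i=1..Suc h. ?x i)"
    by (simp add: z add.commute)
  ultimately show "z \<in> hfold_sumset (Suc h) A"
    unfolding hfold_sumset_def by blast
qed

lemma finite_hfold_sumset: "finite A \<Longrightarrow> finite (hfold_sumset h A)"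
  by (induction h) (simp_all add: hfold_sumset_0 hfold_sumset_Suc)

lemma nmult_add_in_hfold_sumset:
  "x \<in> A \<Longrightarrow> y \<in> hfold_sumset h A \<Longrightarrow> nmult n x + y \<in> hfold_sumset (n + h) A"
  by (induction n) (force simp: hfold_sumset_Suc add.assoc)+

text \<open>Every sum shown to be nontrivial below uses at most three different elements of the set,
  so this form covers all of them.\<close>

lemma three_nmult_in_hfold_sumset:
  assumes "x \<in> A" "y \<in> A" "z \<in> A"
  shows "nmult l x + (nmult m y + nmult n z) \<in> hfold_sumset (l + (m + n)) A"
  using nmult_add_in_hfold_sumset[OF assms(3), of 0 0 n] assms
  by (auto simp: hfold_sumset_0 intro!: nmult_add_in_hfold_sumset)

section \<open>Trivial and nontrivial elements for an increasing sequence\<close>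

lemma sorted_list_of_set_image_strict_mono:
  fixes s :: "nat \<Rightarrow> 'a::linorder"
  assumes "strict_mono_on {..n} s"
  shows "sorted_list_of_set (s ` {..n}) = map s [0..<Suc n]"
proof -
  have "sorted_wrt (<) (map s [0..<Suc n])"
    using assms
    by (auto simp: sorted_wrt_iff_nth_less strict_mono_on_def nth_map simp del: upt_Suc)
  moreover have "set (map s [0..<Suc n]) = s ` {..n}"
    by (auto simp: atLeast0LessThan lessThan_Suc_atMost simp del: upt_Suc)
  ultimately show ?thesis
    by (metis strict_sorted_equal strict_sorted_list_of_set set_sorted_list_of_set
        finite_atMost finite_imageI)
qed

lemma trivial_element_image_iff:
  fixes s :: "nat \<Rightarrow> 'a::linordered_ab_group_add"
  assumes "strict_mono_on {..n} s"
  shows "trivial_element h (s ` {..n}) y \<longleftrightarrow>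
    (\<exists>i\<le>h. \<exists>j<n. y = nmult (h - i) (s j) + nmult i (s (Suc j)))"
proof -
  have "card (s ` {..n}) = Suc n"
    using strict_mono_on_imp_inj_on[OF assms] by (simp add: card_image)
  moreover have "sorted_list_of_set (s ` {..n}) ! j = s j" if "j \<le> n" for j
    using that by (simp add: sorted_list_of_set_image_strict_mono[OF assms] nth_map del: upt_Suc)
  ultimately show ?thesis
    unfolding trivial_element_def by (metis Suc_eq_plus1 Suc_leI Suc_less_eq less_imp_le)
qed

text \<open>A trivial element built from \<open>s j\<close> and \<open>s (Suc j)\<close> lies
  between \<open>h\<close> times the one and \<open>h\<close> times the other. Hence only the gaps
  up to index \<open>r\<close> produce anything below \<open>h\<close> times
  \<open>s (Suc r)\<close>: the gaps before \<open>r\<close> give multiples of \<open>p\<close>, and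
  gap \<open>r\<close> gives the second form.\<close>

lemma trivial_element_below:
  fixes s :: "nat \<Rightarrow> 'a::linordered_ab_group_add"
  assumes mono: "strict_mono_on {..n} s"
    and ap: "\<And>j. j \<le> r \<Longrightarrow> s j = nmult j p"
    and gap: "s (Suc r) = nmult r p + q"
    and triv: "trivial_element h (s ` {..n}) y"
    and less: "y < nmult h (s (Suc r))"
  shows "(\<exists>i\<le>h * r. y = nmult i p) \<or> (\<exists>i. y = nmult (h * r) p + nmult i q)"
proof -
  obtain i j where i: "i \<le> h" and j: "j < n"
    and y: "y = nmult (h - i) (s j) + nmult i (s (Suc j))"
    using triv by (auto simp: trivial_element_image_iff[OF mono])
  have *: "(h - i) * l + i * l = h * l" for l
    using i by (simp flip: add_mult_distrib)
  consider "j < r" | "j = r" | "r < j"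
    by linarith
  then show ?thesis
  proof cases
    case 1
    have "(h - i) * j + i * Suc j = h * j + i"
      using *[of j] by simp
    then have "y = nmult (h * j + i) p"
      unfolding y using 1 ap[of j] ap[of "Suc j"]
      by (metis Suc_leI less_imp_le nmult_add_left nmult_nmult)
    moreover have "h * j + i \<le> h * r"
      using mult_le_mono2[of "Suc j" r h] 1 i by simp
    ultimately show ?thesis
      by blast
  next
    case 2
    have "y = nmult ((h - i) * r + i * r) p + nmult i q"
      by (simp add: y 2 ap gap nmult_add_left nmult_add_right nmult_nmult add.assoc)
    then show ?thesis
      using * by auto
  next
    case 3
    have le: "s (Suc r) \<le> s l" if "Suc r \<le> l" "l \<le> n" for l
      using strict_mono_on_leD[OF mono] that by simp
    have "nmult h (s (Suc r)) = nmult (h - i) (s (Suc r)) + nmult i (s (Suc r))"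
      using i by (simp flip: nmult_add_left)
    also have "\<dots> \<le> y"
      unfolding y using 3 j by (intro add_mono nmult_mono le) auto
    finally show ?thesis
      using less by simp
  qed
qed

lemma card_nontrivial_elements_ge:
  fixes s :: "nat \<Rightarrow> 'a::linordered_ab_group_add"
  assumes mono: "strict_mono_on {..n} s"
    and ap: "\<And>j. j \<le> r \<Longrightarrow> s j = nmult j p"
    and gap: "s (Suc r) = nmult r p + q"
    and r: "0 < r" "r < n"
    and pos: "0 < p" "0 < q"
    and neq: "p \<noteq> q"
  shows "h - 1 \<le> card (nontrivial_elements h (s ` {..n}))"
proof -
  let ?B = "s ` {..n}"
  have B: "s j \<in> ?B" if "j \<le> Suc r" for j
    using that r by auto
  have top: "nmult h (s (Suc r)) = nmult (h * r) p + nmult h q"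
    by (simp add: gap nmult_add_right nmult_nmult)
  \<comment> \<open>Both cases for \<open>q\<close> supply \<open>h - 1\<close> distinct sums. The
    bound \<open>less\<close> makes \<open>trivial_element_below\<close> applicable;
    \<open>ne1\<close> and \<open>ne2\<close> refute its two alternatives.\<close>
  have suffices: ?thesis
    if inj: "inj_on f {1..h - 1}"
      and mem: "\<And>i. 1 \<le> i \<Longrightarrow> i < h \<Longrightarrow> f i \<in> hfold_sumset h ?B"
      and less: "\<And>i. 1 \<le> i \<Longrightarrow> i < h \<Longrightarrow> f i < nmult (h * r) p + nmult h q"
      and ne1: "\<And>i l. 1 \<le> i \<Longrightarrow> i < h \<Longrightarrow> l \<le> h * r \<Longrightarrow> f i \<noteq> nmult l p"
      and ne2: "\<And>i l. 1 \<le> i \<Longrightarrow> i < h \<Longrightarrow> f i \<noteq> nmult (h * r) p + nmult l q"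
    for f :: "nat \<Rightarrow> 'a"
  proof -
    have "f ` {1..h - 1} \<subseteq> nontrivial_elements h ?B"
    proof (rule image_subsetI)
      fix i assume "i \<in> {1..h - 1}"
      then have i: "1 \<le> i" "i < h"
        by auto
      have "\<not> trivial_element h ?B (f i)"
        using trivial_element_below[OF mono ap gap, of h "f i"] less[OF i] ne1[OF i] ne2[OF i]
        by (auto simp: top)
      then show "f i \<in> nontrivial_elements h ?B"
        using mem[OF i] by (simp add: nontrivial_elements_def)
    qed
    moreover have "finite (nontrivial_elements h ?B)"
      by (simp add: nontrivial_elements_def finite_hfold_sumset)
    ultimately have "card (f ` {1..h - 1}) \<le> card (nontrivial_elements h ?B)"
      by (rule card_mono[rotated])
    then show ?thesis
      using card_image[OF inj] by simp
  qed
  show ?thesis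
  proof (cases "\<exists>m. q = nmult m p")
    case False
    let ?f = "\<lambda>i. nmult (i * r) p + q"
    show ?thesis
    proof (rule suffices[of ?f])
      show "inj_on ?f {1..h - 1}"
        using r pos by (auto intro!: inj_onI simp: nmult_eq_iff)
    next
      fix i assume i: "1 \<le> i" "i < h"
      \<comment> \<open>Since \<open>s 0 = 0\<close>, the first summand only pads the number of
        terms up to \<open>h\<close>.\<close>
      have "?f i = nmult (h - i) (s 0) + (nmult (i - 1) (s r) + nmult 1 (s (Suc r)))"
      proof -
        have "i * r = (i - 1) * r + r"
          using i by (simp add: mult_eq_if)
        then show ?thesis
          by (simp add: ap gap nmult_nmult nmult_add_left add.assoc)
      qed
      also have "\<dots> \<in> hfold_sumset (h - i + (i - 1 + 1)) ?B"
        by (intro three_nmult_in_hfold_sumset B) auto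
      finally show "?f i \<in> hfold_sumset h ?B"
        using i by simp
      have less: "nmult (i * r) p < nmult (h * r) p"
        using i r pos by (simp add: nmult_less_iff)
      have q: "q \<le> nmult (Suc l) q" for l
        using nmult_le_iff[OF pos(2), of 1 "Suc l"] by simp
      show "?f i < nmult (h * r) p + nmult h q"
        using less q[of "h - 1"] i by (intro add_less_le_mono) auto
      \<comment> \<open>Cancelling \<open>i * r\<close> copies of \<open>p\<close> would exhibit
        \<open>q\<close> itself as a multiple of \<open>p\<close>.\<close>
      have multiple: "?f i \<noteq> nmult l p" for l
      proof
        assume eq: "?f i = nmult l p"
        then have "nmult (i * r) p < nmult l p"
          using pos by (metis less_add_same_cancel1)
        then have "i * r \<le> l"
          using pos by (simp add: nmult_less_iff)
        then have "nmult l p = nmult (i * r) p + nmult (l - i * r) p"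
          by (simp flip: nmult_add_left)
        with eq False show False
          by auto
      qed
      then show "?f i \<noteq> nmult l p" for l .
      \<comment> \<open>For \<open>l = 0\<close> the right side is a multiple of \<open>p\<close>;
        for positive \<open>l\<close> it is too large, because \<open>i < h\<close>.\<close>
      show "?f i \<noteq> nmult (h * r) p + nmult l q" for l
      proof (cases l)
        case 0
        then show ?thesis
          using multiple by simp
      next
        case (Suc l')
        have "?f i < nmult (h * r) p + nmult l q"
          unfolding Suc using less q by (rule add_less_le_mono)
        then show ?thesis
          by simp
      qed
    qed
  next
    case True
    then obtain m where m: "q = nmult m p"
      by blast
    have "m \<noteq> 0"
      using pos m by (metis less_irrefl nmult_0)
    moreover have "m \<noteq> 1"
      using neq m by auto
    ultimately have m2: "2 \<le> m"
      by simp
    let ?f = "\<lambda>i. nmult (h * r - 1 + i * m) p"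
    show ?thesis
    proof (rule suffices[of ?f])
      show "inj_on ?f {1..h - 1}"
        using m2 pos by (auto intro!: inj_onI simp: nmult_eq_iff)
    next
      fix i assume i: "1 \<le> i" "i < h"
      have hr: "1 \<le> h * r"
        using i r by (simp add: Suc_le_eq)
      have im: "2 \<le> i * m"
        using i m2 mult_le_mono[of 1 i 2 m] by simp
      \<comment> \<open>The single term \<open>s (r - 1)\<close>, available because
        \<open>0 < r\<close>, lowers the coefficient of \<open>p\<close> by one. This takes the sum
        out of the residue class of \<open>h * r\<close> modulo \<open>m\<close>.\<close>
      have "?f i = nmult 1 (s (r - 1)) + (nmult (h - 1 - i) (s r) + nmult i (s (Suc r)))"
      proof -
        have "h = Suc (h - 1 - i + i)"
          using i by simp
        then have "h * r = r + ((h - 1 - i) * r + i * r)"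
          by (metis add_mult_distrib mult_Suc)
        then have "h * r - 1 + i * m = (r - 1) + ((h - 1 - i) * r + (i * r + i * m))"
          using r by simp
        then show ?thesis
          by (simp add: ap gap m nmult_nmult nmult_add_left nmult_add_right)
      qed
      also have "\<dots> \<in> hfold_sumset (1 + (h - 1 - i + i)) ?B"
        by (intro three_nmult_in_hfold_sumset B) auto
      finally show "?f i \<in> hfold_sumset h ?B"
        using i by simp
      have fold: "nmult (h * r) p + nmult l q = nmult (h * r + l * m) p" for l
        by (simp add: m nmult_nmult nmult_add_left)
      have "i * m \<le> h * m"
        using i by simp
      then show "?f i < nmult (h * r) p + nmult h q"
        unfolding fold nmult_less_iff[OF pos(1)] using hr by linarith
      \<comment> \<open>Here the sum is a multiple of \<open>p\<close>, but its coefficient exceeds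
        \<open>h * r\<close> since \<open>2 \<le> i * m\<close>.\<close>
      show "?f i \<noteq> nmult l p" if "l \<le> h * r" for l
        unfolding nmult_eq_iff[OF pos(1)] using that hr im by linarith
      show "?f i \<noteq> nmult (h * r) p + nmult l q" for l
        unfolding fold nmult_eq_iff[OF pos(1)]
      proof
        assume "h * r - 1 + i * m = h * r + l * m"
        then have "i * m = l * m + 1"
          using hr by linarith
        then have "m dvd 1"
          by (metis dvd_add_right_iff dvd_triv_right)
        then show False
          using m2 by simp
      qed
    qed
  qed
qed

theorem theorem3p5:
  fixes h k :: nat
    and a :: "'a::linordered_ab_group_add"
    and b :: "nat \<Rightarrow> 'a"
    and A B :: "'a set"
  assumes "h \<ge> 2"
    and "k \<ge> 4"
    and "0 < a"
    and "\<And>i. i \<in> {1..k - 2} \<Longrightarrow> 0 < b i"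
    and "b (k - 2) = b (k - 3)"
    and "A = insert 0 {a + (\<Sum>i=1..j. b i) | j. j \<le> k - 2}"
    and "B = insert 0 {a + (\<Sum>i=1..j. b i) | j. j \<le> k - 3}"
  shows "is_arith_prog k A \<or> card (nontrivial_elements h B) \<ge> h - 1"
proof -
  \<comment> \<open>Treating \<open>a\<close> as gap number 0 makes the elements of \<open>A\<close>
    the partial sums of one sequence.\<close>
  define d where "d = b(0 := a)"
  define s where "s j = (\<Sum>i<j. d i)" for j
  have s_0: "s 0 = 0" and s_Suc: "s (Suc j) = s j + d j" for j
    by (simp_all add: s_def)
  have s_b: "s (Suc j) = a + (\<Sum>i=1..j. b i)" for j
    by (induction j) (simp_all add: s_def d_def add.assoc)
  have image: "insert 0 {a + (\<Sum>i=1..j. b i) | j. j \<le> n} = s ` {..Suc n}" for n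
    unfolding s_b[symmetric] atMost_Suc_eq_insert_0 using s_0 by auto
  have A: "A = s ` {..k - 1}" and B: "B = s ` {..k - 2}"
    using assms(2) image[of "k - 2"] image[of "k - 3"] assms(6,7)
    by (simp_all add: Suc_diff_le numeral_eq_Suc Suc_diff_Suc)
  have d_pos: "0 < d i" if "i \<le> k - 2" for i
    using that assms(3,4) by (auto simp: d_def)
  have s_ap: "s j = nmult j a" if "\<And>i. i < j \<Longrightarrow> d i = a" for j
    using that by (simp add: s_def nmult_def)
  show ?thesis
  proof (cases "\<forall>i<k - 2. d i = a")
    case True
    \<comment> \<open>As \<open>k \<ge> 4\<close>, the index \<open>k - 3\<close> is positive, so
      \<open>d\<close> agrees with \<open>b\<close> at both places. This extends the common gap of
      \<open>B\<close> to the last gap of \<open>A\<close>.\<close>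
    moreover have "d (k - 2) = d (k - 3)"
      using assms(2,5) by (simp add: d_def)
    ultimately have "d i = a" if "i < k - 1" for i
      using that assms(2) by (cases "i = k - 2") auto
    then have "s j = nmult j a" if "j < k" for j
      using that by (intro s_ap) auto
    then have "A = {0 + nmult i a | i. i < k}"
      using assms(2) unfolding A by (force simp: image_iff)
    then show ?thesis
      using assms(3) unfolding is_arith_prog_def
      by (intro disjI1 exI[of _ 0] exI[of _ a] conjI) simp_all
  next
    case False
    define r where "r = (LEAST i. i < k - 2 \<and> d i \<noteq> a)"
    have r: "r < k - 2" "d r \<noteq> a"
      using False LeastI_ex[of "\<lambda>i. i < k - 2 \<and> d i \<noteq> a"] by (auto simp: r_def)
    have below: "d i = a" if "i < r" for i
      using not_less_Least[of i "\<lambda>i. i < k - 2 \<and> d i \<noteq> a"] that r by (auto simp: r_def)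
    \<comment> \<open>Gap 0 is \<open>a\<close> by construction, so it cannot be the first one to
      differ.\<close>
    have "0 < r"
      using r(2) by (cases r) (simp_all add: d_def)
    have mono: "strict_mono_on {..k - 2} s"
    proof (rule strict_mono_onI)
      fix i j assume "i \<in> {..k - 2}" "j \<in> {..k - 2}" "i < j"
      then have "0 < (\<Sum>l=i..<j. d l)"
        by (intro sum_pos d_pos) auto
      then show "s i < s j"
        using sum.atLeastLessThan_concat[of 0 i j d] \<open>i < j\<close>
        by (simp add: s_def lessThan_atLeast0) (metis less_add_same_cancel1)
    qed
    have "h - 1 \<le> card (nontrivial_elements h (s ` {..k - 2}))"
    proof (rule card_nontrivial_elements_ge[OF mono])
      show ap: "s j = nmult j a" if "j \<le> r" for j
        using that below by (intro s_ap) auto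
      show "s (Suc r) = nmult r a + d r"
        by (simp add: s_Suc ap)
    qed (use r \<open>0 < r\<close> assms(3) d_pos in auto)
    then show ?thesis
      by (simp add: B)
  qed
qed

end
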